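(* Let $r\le0$, let $j_0\in D(\mathbb{R}^3;\mathbb{R})$ be spherically symmetric with $q:=\int j_0(\mathbf x)\,d^3\mathbf x\neq0$, and let $\mathbf v^{\mathrm{in}},\mathbf v^{\mathrm{out}}\in\mathbb{R}^3$ with $|\mathbf v^{\mathrm{in}}|,|\mathbf v^{\mathrm{out}}|<1$ and $\mathbf v^{\mathrm{in}}\neq\mathbf v^{\mathrm{out}}$. For $\mathbf v\in\{\mathbf v^{\mathrm{in}},\mathbf v^{\mathrm{out}}\}$ let $g^{\mathbf v}(\mathbf k)=i\tilde j_0(\mathbf k)|\mathbf k|^{-3/2}(1-\hat{\mathbf k}\cdot\mathbf v)^{-1}$ and $g^{\mathbf v}_\sigma(\mathbf k)=\chi_{[\sigma,\infty)}(|\mathbf k|)g^{\mathbf v}(\mathbf k)$. Then $\lim_{\sigma\to0}\|T_r(g^{\mathbf v^{\mathrm{out}}}_\sigma-g^{\mathbf v^{\mathrm{in}}}_\sigma)\|_2=\infty$.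
   Context: $\hat{\mathbf k}=\mathbf k/|\mathbf k|$, $\tilde j_0(\mathbf k)=(2\pi)^{-3/2}\int e^{-i\mathbf k\cdot\mathbf x}j_0(\mathbf x)d^3\mathbf x$. Let $\varepsilon_i=2^{-(i-1)}$, $b_i=1/i$ ($i\ge1$), $\tau_i=\varepsilon_i^{\,r-1}$, $\mu(\mathbf k)=|\mathbf k|$, $u_s$ = multiplication by $e^{i\mu s}$ on $L^2(\mathbb{R}^3)$, $\zeta^\circ_i(|\mathbf k|)=(\log2)^{-1/2}\chi_{[\varepsilon_{i+1},\varepsilon_i]}(|\mathbf k|)|\mathbf k|^{-3/2}$, and $Q_i$ the orthogonal projection onto span$\{\zeta^\circ_i(|\mathbf k|)Y_{\ell m}(\hat{\mathbf k}):0\le\ell\le i,|m|\le\ell\}$, $Y_{\ell m}$ real spherical harmonics. $T_r=1+\sum_i(b_i^{-1}-1)u_{-\tau_i}Q_i\,\mathrm{Re}\,u_{\tau_i}+i\sum_i(b_i-1)u_{-\tau_i}Q_i\,\mathrm{Im}\,u_{\tau_i}$ (real-linear; Re, Im pointwise; only finitely many terms act nontrivially on the cut-off functions). *)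

theory Defs
  imports "HOL-Analysis.Analysis" "HOL-Computational_Algebra.Polynomial"
begin

type_synonym R3 = "real^3"

definition partial_deriv :: "(R3 \<Rightarrow> real) \<Rightarrow> 3 \<Rightarrow> R3 \<Rightarrow> real" where
  "partial_deriv f j x = deriv (\<lambda>t. f (x + t *\<^sub>R axis j 1)) 0"

fun iter_partials :: "nat \<Rightarrow> (R3 \<Rightarrow> real) \<Rightarrow> (R3 \<Rightarrow> real) set" where
  "iter_partials 0 f = {f}"
| "iter_partials (Suc n) f = {partial_deriv g j | g j. g \<in> iter_partials n f}"

definition smooth3 :: "(R3 \<Rightarrow> real) \<Rightarrow> bool" where
  "smooth3 f \<longleftrightarrow> (\<forall>n. \<forall>g\<in>iter_partials n f.
      continuous_on UNIV g \<and> (\<forall>x j. (\<lambda>t. g (x + t *\<^sub>R axis j 1)) differentiable (at 0)))"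

definition test_function :: "(R3 \<Rightarrow> real) \<Rightarrow> bool" where
  "test_function f \<longleftrightarrow> smooth3 f \<and> compact (closure {x. f x \<noteq> 0})"

definition spherically_symmetric :: "(R3 \<Rightarrow> real) \<Rightarrow> bool" where
  "spherically_symmetric f \<longleftrightarrow> (\<forall>x y. norm x = norm y \<longrightarrow> f x = f y)"

definition fourier3 :: "(R3 \<Rightarrow> real) \<Rightarrow> R3 \<Rightarrow> complex" where
  "fourier3 f k = complex_of_real ((2 * pi) powr (-3/2)) *
      (LINT x|lborel. cis (- (k \<bullet> x)) * complex_of_real (f x))"

definition l2norm :: "(R3 \<Rightarrow> complex) \<Rightarrow> ereal" where
  "l2norm f = (let N = (\<integral>\<^sup>+ k. ennreal ((cmod (f k))\<^sup>2) \<partial>lborel)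
               in if N = top then PInfty else ereal (sqrt (enn2real N)))"

definition khat :: "R3 \<Rightarrow> R3" where
  "khat k = k /\<^sub>R norm k"

text \<open>Legendre polynomial via Rodrigues' formula.\<close>
definition legendre :: "nat \<Rightarrow> real poly" where
  "legendre l = smult (1 / (2 ^ l * fact l)) ((pderiv ^^ l) ([:-1, 0, 1:] ^ l))"

text \<open>Real spherical harmonic Y_lm evaluated at a point w of the unit sphere,
  w = (x,y,z) = (sin t cos p, sin t sin p, cos t).  Using
  P_l^m(z) = (1-z^2)^(m/2) P_l^(m)(z) and (sin t) e^(i m p) = (x + i y)^m,
  Y_lm = N_lm P_l^m(cos t) cos(m p) for m > 0, N_l0 P_l(cos t) for m = 0,
  N_lm P_l^|m|(cos t) sin(|m| p) for m < 0.\<close>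
definition sph_harm :: "nat \<Rightarrow> int \<Rightarrow> R3 \<Rightarrow> real" where
  "sph_harm l m w =
     (let a = nat \<bar>m\<bar>;
          N = sqrt ((2 * real l + 1) / (4 * pi) * fact (l - a) / fact (l + a))
              * (if m = 0 then 1 else sqrt 2);
          z = Complex (w $ 1) (w $ 2) ^ a;
          ang = (if m \<ge> 0 then Re z else Im z)
      in N * poly ((pderiv ^^ a) (legendre l)) (w $ 3) * ang)"

definition eps :: "nat \<Rightarrow> real" where "eps i = (1/2) ^ (i - 1)"
definition bcoef :: "nat \<Rightarrow> real" where "bcoef i = 1 / real i"
definition tau :: "real \<Rightarrow> nat \<Rightarrow> real" where "tau r i = eps i powr (r - 1)"

definition u_op :: "real \<Rightarrow> (R3 \<Rightarrow> complex) \<Rightarrow> R3 \<Rightarrow> complex" where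
  "u_op s f k = cis (norm k * s) * f k"

definition zeta :: "nat \<Rightarrow> real \<Rightarrow> real" where
  "zeta i t = (ln 2) powr (-1/2) * indicator {eps (Suc i) .. eps i} t * t powr (-3/2)"

definition harm_idx :: "nat \<Rightarrow> (nat \<times> int) set" where
  "harm_idx i = {(l, m). l \<le> i \<and> \<bar>m\<bar> \<le> int l}"

definition basis_fn :: "nat \<Rightarrow> nat \<Rightarrow> int \<Rightarrow> R3 \<Rightarrow> complex" where
  "basis_fn i l m k = complex_of_real (zeta i (norm k) * sph_harm l m (khat k))"

definition Vspace :: "nat \<Rightarrow> (R3 \<Rightarrow> complex) set" where
  "Vspace i = {(\<lambda>k. \<Sum>(l, m)\<in>harm_idx i. c (l, m) * basis_fn i l m k) | c. True}"

definition Qproj :: "nat \<Rightarrow> (R3 \<Rightarrow> complex) \<Rightarrow> R3 \<Rightarrow> complex" where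
  "Qproj i f = (THE g. g \<in> Vspace i \<and>
      (\<forall>h\<in>Vspace i. (LINT k|lborel. (f k - g k) * cnj (h k)) = 0))"

definition T_op :: "real \<Rightarrow> (R3 \<Rightarrow> complex) \<Rightarrow> R3 \<Rightarrow> complex" where
  "T_op r f k = f k
     + (\<Sum>n. (let i = Suc n in
          complex_of_real (1 / bcoef i - 1) *
          u_op (- tau r i) (Qproj i (\<lambda>k'. complex_of_real (Re (u_op (tau r i) f k')))) k))
     + \<i> * (\<Sum>n. (let i = Suc n in
          complex_of_real (bcoef i - 1) *
          u_op (- tau r i) (Qproj i (\<lambda>k'. complex_of_real (Im (u_op (tau r i) f k')))) k))"

definition gfun :: "(R3 \<Rightarrow> real) \<Rightarrow> R3 \<Rightarrow> R3 \<Rightarrow> complex" where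
  "gfun j0 v k = \<i> * fourier3 j0 k * complex_of_real (norm k powr (-3/2))
                  / complex_of_real (1 - khat k \<bullet> v)"

definition gcut :: "(R3 \<Rightarrow> real) \<Rightarrow> R3 \<Rightarrow> real \<Rightarrow> R3 \<Rightarrow> complex" where
  "gcut j0 v \<sigma> k = complex_of_real (indicator {\<sigma>..} (norm k)) * gfun j0 v k"

end

theory Submission
  imports Defs
begin

text \<open>
  Write \<open>U\<^sub>i\<close> for the open shell \<open>\<epsilon>\<^sub>i\<^sub>+\<^sub>1 < |k| < \<epsilon>\<^sub>i\<close>. On \<open>U\<^sub>i\<close> only the projection \<open>Q\<^sub>i\<close> contributes, and its
  range consists of products of \<open>|k| powr (-3/2)\<close> with functions of the direction of \<open>k\<close>. Hence there
  \<open>|T\<^sub>r f|\<^sup>2 = |k| powr (-3) |cis (\<tau>\<^sub>i |k|) a(k) F(k) + z(k)|\<^sup>2\<close>, where \<open>a\<close> is \<open>\<i>\<close> times the Fourier transform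
  of the charge density and \<open>F\<close>, \<open>z\<close> depend on the direction of \<open>k\<close> only. Whatever \<open>z\<close> is, it cannot
  cancel the first summand, because \<open>\<tau>\<^sub>i \<epsilon>\<^sub>i \<ge> 1\<close> makes the phase vary by a fixed amount in radial
  direction. By scale invariance every shell close to the origin therefore contributes at least
  a fixed positive amount to the squared norm, and the number of shells above the cutoff tends
  to infinity.
\<close>

subsection \<open>Integration and the Fourier transform\<close>

text \<open>Serves twice: to bring a shell to a fixed size, and to compare an integrand at
  \<open>k\<close> with its value at a multiple of \<open>k\<close>.\<close>

lemma nn_integral_lborel_scale:
  fixes f :: "'a::euclidean_space \<Rightarrow> ennreal" and c :: real
  assumes [measurable]: "f \<in> borel_measurable borel" and "c > 0"
  shows "(\<integral>\<^sup>+x. f x \<partial>lborel) = (\<integral>\<^sup>+x. ennreal (c ^ DIM('a)) * f (c *\<^sub>R x) \<partial>lborel)"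
proof -
  have "(\<integral>\<^sup>+x. f x \<partial>lborel) = 
    (\<integral>\<^sup>+x. f x \<partial>density (distr lborel borel (\<lambda>x::'a. 0 + c *\<^sub>R x)) (\<lambda>_. ennreal (\<bar>c\<bar> ^ DIM('a))))"
    using lborel_affine[of c "0::'a"] assms(2) by simp
  also have "\<dots> = (\<integral>\<^sup>+x. ennreal (c ^ DIM('a)) * f (c *\<^sub>R x) \<partial>lborel)"
    using assms(2) by (simp add: nn_integral_density nn_integral_distr)
  finally show ?thesis .
qed

text \<open>A nonempty open set contains a ball, which has positive volume. This turns
  almost-everywhere statements about continuous functions into pointwise ones.\<close>

lemma AE_lborel_open_imp_empty:
  fixes U :: "'a::euclidean_space set"
  assumes "open U" "AE x in lborel. x \<notin> U"
  shows "U = {}"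
proof (rule ccontr)
  assume "U \<noteq> {}"
  then obtain x e where "e > 0" and sub: "ball x e \<subseteq> U"
    using assms(1) open_contains_ball by (metis all_not_in_conv)
  have "U \<in> null_sets lborel"
    using assms by (subst AE_iff_null_sets) auto
  then have "ball x e \<in> null_sets lborel"
    using sub by (auto intro: null_sets_subset)
  then have "measure lborel (ball x e) = 0"
    by (simp add: measure_eq_0_null_sets)
  with content_ball_pos[OF \<open>e > 0\<close>, of x] show False by simp
qed

lemma integrable_test_function:
  assumes "test_function j"
  shows "integrable lborel j"
proof -
  have cont: "continuous_on UNIV j"
    using assms unfolding test_function_def smooth3_def by (metis iter_partials.simps(1) singletonI)
  have "integrable lborel (\<lambda>x. indicator (closure {x. j x \<noteq> 0}) x *\<^sub>R j x)"
    using assms continuous_on_subset[OF cont] unfolding test_function_def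
    by (intro borel_integrable_compact) auto
  moreover have "(\<lambda>x. indicator (closure {x. j x \<noteq> 0}) x *\<^sub>R j x) = j"
    using closure_subset[of "{x. j x \<noteq> 0}"] by (auto simp: fun_eq_iff indicator_def)
  ultimately show ?thesis by simp
qed

text \<open>Dominated convergence with majorant \<open>norm (j x)\<close>, since the phase has
  modulus one. Continuity at 0 later makes the transform nearly constant on small shells.\<close>

lemma continuous_fourier3:
  assumes "integrable lborel j"
  shows "continuous_on UNIV (fourier3 j)"
proof -
  have [measurable]: "j \<in> borel_measurable borel"
    using assms by auto
  have "continuous_on UNIV (\<lambda>k. LINT x|lborel. cis (- (k \<bullet> x)) * complex_of_real (j x))"
  proof (rule continuous_on_sequentiallyI)
    fix u and a :: R3
    assume u: "u \<longlonglongrightarrow> a"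
    have "(\<lambda>n. cis (- (u n \<bullet> x)) * complex_of_real (j x)) \<longlonglongrightarrow> cis (- (a \<bullet> x)) * complex_of_real (j x)" for x
      by (intro tendsto_intros u)
    moreover have [measurable]: "(\<lambda>x::R3. cis (- (a \<bullet> x))) \<in> borel_measurable borel" for a
      by (intro borel_measurable_continuous_onI continuous_intros)
    ultimately show "(\<lambda>n. LINT x|lborel. cis (- (u n \<bullet> x)) * complex_of_real (j x))
        \<longlonglongrightarrow> (LINT x|lborel. cis (- (a \<bullet> x)) * complex_of_real (j x))"
      using integrable_norm[OF assms]
      by (intro integral_dominated_convergence[where w="\<lambda>x. norm (j x)"]) (auto simp: norm_mult)
  qed
  then show ?thesis
    unfolding fourier3_def by (intro continuous_intros)
qed

lemma fourier3_0:
  "fourier3 j 0 = complex_of_real ((2 * pi) powr (-3/2) * (LINT x|lborel. j x))"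
  unfolding fourier3_def by simp

section \<open>Orthogonal projection onto a finite span\<close>

text \<open>Induction by a Gram-Schmidt step: \<open>p\<close> and \<open>q\<close> are the
  residuals of \<open>f\<close> and of the new vector \<open>b s\<close> over \<open>S\<close>, and
  a suitable \<open>p - e * q\<close> is the residual of \<open>f\<close> over
  \<open>insert s S\<close>. The family may be linearly dependent.\<close>

lemma ex_orthogonal_projection:
  fixes b :: "'i \<Rightarrow> 'a \<Rightarrow> complex" and f :: "'a \<Rightarrow> complex"
  assumes "finite S"
    and "\<And>i j. i \<in> S \<Longrightarrow> j \<in> S \<Longrightarrow> integrable M (\<lambda>x. b i x * cnj (b j x))"
    and "\<And>j. j \<in> S \<Longrightarrow> integrable M (\<lambda>x. f x * cnj (b j x))"
  shows "\<exists>c. \<forall>j\<in>S. (LINT x|M. (f x - (\<Sum>i\<in>S. c i * b i x)) * cnj (b j x)) = 0"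
  using assms
proof (induction S arbitrary: f rule: finite_induct)
  case empty
  then show ?case by simp
next
  case (insert s S)
  have "\<exists>c. \<forall>j\<in>S. (LINT x|M. (f x - (\<Sum>i\<in>S. c i * b i x)) * cnj (b j x)) = 0"
    using insert by auto
  then obtain c where c: "\<And>j. j\<in>S \<Longrightarrow> (LINT x|M. (f x - (\<Sum>i\<in>S. c i * b i x)) * cnj (b j x)) = 0"
    by blast
  have "\<exists>c. \<forall>j\<in>S. (LINT x|M. (b s x - (\<Sum>i\<in>S. c i * b i x)) * cnj (b j x)) = 0"
    using insert by auto
  then obtain d where d: "\<And>j. j\<in>S \<Longrightarrow> (LINT x|M. (b s x - (\<Sum>i\<in>S. d i * b i x)) * cnj (b j x)) = 0"
    by blast
  define p where "p = (\<lambda>x. f x - (\<Sum>i\<in>S. c i * b i x))"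
  define q where "q = (\<lambda>x. b s x - (\<Sum>i\<in>S. d i * b i x))"
  have int_b: "integrable M (\<lambda>x. b i x * cnj (b j x))" if "i \<in> insert s S" "j \<in> insert s S" for i j
    using insert.prems(1)[OF that] .
  have int_p: "integrable M (\<lambda>x. p x * cnj (b j x))" if "j \<in> insert s S" for j
    unfolding p_def using that insert.prems(2)[OF that] int_b
    by (auto simp: left_diff_distrib sum_distrib_right mult.assoc)
  have int_q: "integrable M (\<lambda>x. q x * cnj (b j x))" if "j \<in> insert s S" for j
    unfolding q_def using that int_b
    by (auto simp: left_diff_distrib sum_distrib_right mult.assoc)
  have q_orth: "(LINT x|M. q x * cnj (b j x)) = 0" if "j \<in> S" for j
    using d[OF that] by (simp add: q_def)
  have p_orth: "(LINT x|M. p x * cnj (b j x)) = 0" if "j \<in> S" for j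
    using c[OF that] by (simp add: p_def)
  have expand_q: "h x * cnj (q x) = h x * cnj (b s x) - (\<Sum>i\<in>S. cnj (d i) * (h x * cnj (b i x)))" for h x
    by (simp add: q_def algebra_simps sum_distrib_left)
  have pq: "(LINT x|M. p x * cnj (q x)) = (LINT x|M. p x * cnj (b s x))"
      "integrable M (\<lambda>x. p x * cnj (q x))"
    unfolding expand_q using int_p p_orth by auto
  have qq: "(LINT x|M. q x * cnj (q x)) = (LINT x|M. q x * cnj (b s x))"
      "integrable M (\<lambda>x. q x * cnj (q x))"
    unfolding expand_q using int_q q_orth by auto
  \<comment> \<open>This \<open>e\<close> makes \<open>p - e * q\<close> orthogonal to
    \<open>b s\<close>. If the denominator is 0, then \<open>e = 0\<close> and the numerator must
    vanish as well: the denominator is the squared norm of \<open>q\<close>, so \<open>q\<close> is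
    0 almost everywhere, and the numerator equals the pairing of \<open>p\<close> with
    \<open>q\<close>.\<close>
  define e where "e = (LINT x|M. p x * cnj (b s x)) / (LINT x|M. q x * cnj (b s x))"
  have "(LINT x|M. p x * cnj (b s x)) = 0" if "(LINT x|M. q x * cnj (b s x)) = 0"
  proof -
    have "complex_of_real (LINT x|M. (cmod (q x))\<^sup>2) = 0"
      using qq(1) that by (simp add: complex_norm_square[symmetric] flip: integral_complex_of_real)
    moreover have "integrable M (\<lambda>x. (cmod (q x))\<^sup>2)"
      using integrable_norm[OF qq(2)] by (simp add: norm_mult power2_eq_square)
    ultimately have "AE x in M. q x = 0"
      using integral_nonneg_eq_0_iff_AE[of M "\<lambda>x. (cmod (q x))\<^sup>2"] by simp
    then have "AE x in M. p x * cnj (q x) = 0"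
      by eventually_elim simp
    then show ?thesis
      using integral_cong_AE[of "\<lambda>x. p x * cnj (q x)" M "\<lambda>_. 0"] pq by auto
  qed
  then have e: "(LINT x|M. p x * cnj (b s x)) = e * (LINT x|M. q x * cnj (b s x))"
    by (cases "(LINT x|M. q x * cnj (b s x)) = 0") (simp_all add: e_def)
  \<comment> \<open>The coefficients found by expanding \<open>p - e * q\<close>; the new vector
    \<open>b s\<close> enters only through \<open>q\<close>.\<close>
  define c' where "c' = (\<lambda>i. if i = s then e else c i - e * d i)"
  have eq: "f x - (\<Sum>i\<in>insert s S. c' i * b i x) = p x - e * q x" for x
  proof -
    have "(\<Sum>i\<in>S. c' i * b i x) = (\<Sum>i\<in>S. (c i - e * d i) * b i x)"
      using insert.hyps by (intro sum.cong) (auto simp: c'_def)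
    then show ?thesis
      using insert.hyps by (simp add: p_def q_def c'_def algebra_simps sum_subtractf sum_distrib_left)
  qed
  show ?case
  proof (intro exI[of _ c'] ballI)
    fix j assume j: "j \<in> insert s S"
    have "(LINT x|M. (f x - (\<Sum>i\<in>insert s S. c' i * b i x)) * cnj (b j x))
        = (LINT x|M. p x * cnj (b j x) - e * (q x * cnj (b j x)))"
      unfolding eq by (simp add: left_diff_distrib mult.assoc)
    also have "\<dots> = (LINT x|M. p x * cnj (b j x)) - e * (LINT x|M. q x * cnj (b j x))"
      using int_p[OF j] int_q[OF j] by simp
    also have "\<dots> = 0"
      using j e p_orth q_orth by auto
    finally show "(LINT x|M. (f x - (\<Sum>i\<in>insert s S. c' i * b i x)) * cnj (b j x)) = 0" .
  qed
qed

subsection \<open>The spaces spanned by spherical harmonics on a shell\<close>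

lemma eps_pos [simp]: "eps i > 0"
  by (simp add: eps_def)

text \<open>Indices start at 1: truncated subtraction gives \<open>eps 0 = eps 1 = 1\<close>, so the
  halving fails at 0.\<close>

lemma eps_Suc: "i \<ge> 1 \<Longrightarrow> eps (Suc i) = eps i / 2"
  by (cases i) (simp_all add: eps_def)

lemma eps_antimono: "i \<le> j \<Longrightarrow> eps j \<le> eps i"
  by (simp add: eps_def power_decreasing)

lemma eps_tendsto_0: "eps \<longlonglongrightarrow> 0"
  by (rule LIMSEQ_imp_Suc) (simp add: eps_def LIMSEQ_power_zero)

lemma khat_scaleR: "c > 0 \<Longrightarrow> khat (c *\<^sub>R k) = khat k"
  by (simp add: khat_def)

lemma continuous_on_khat: "continuous_on (- {0}) khat"
  unfolding khat_def by (intro continuous_intros) auto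

lemma measurable_khat [measurable]: "khat \<in> borel_measurable borel"
  unfolding khat_def by measurable

lemma continuous_on_sph_harm: "continuous_on UNIV (sph_harm l m)"
  unfolding sph_harm_def Let_def Complex_eq
  by (cases "m \<ge> 0") (auto intro!: continuous_intros)

lemma finite_harm_idx: "finite (harm_idx i)"
proof (rule finite_subset)
  show "harm_idx i \<subseteq> {..i} \<times> {- int i..int i}"
    by (auto simp: harm_idx_def)
qed simp

lemma mem_Vspace_iff:
  "g \<in> Vspace i \<longleftrightarrow> (\<exists>c. g = (\<lambda>k. \<Sum>p\<in>harm_idx i. c p * basis_fn i (fst p) (snd p) k))"
  unfolding Vspace_def by (simp add: case_prod_beta)

text \<open>All basis functions share the radial factor. The angular factor is continuous on the
  whole space, because \<open>sph_harm\<close> is a polynomial in the coordinates.\<close>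

lemma Vspace_E:
  assumes "g \<in> Vspace i"
  obtains Y where "continuous_on UNIV Y" "\<And>k. g k = complex_of_real (zeta i (norm k)) * Y (khat k)"
proof -
  obtain c where c: "g = (\<lambda>k. \<Sum>p\<in>harm_idx i. c p * basis_fn i (fst p) (snd p) k)"
    using assms unfolding mem_Vspace_iff by blast
  show thesis
  proof
    show "continuous_on UNIV (\<lambda>w. \<Sum>p\<in>harm_idx i. c p * complex_of_real (sph_harm (fst p) (snd p) w))"
      by (auto intro!: continuous_intros continuous_on_sph_harm)
    show "g k = complex_of_real (zeta i (norm k)) *
        (\<Sum>p\<in>harm_idx i. c p * complex_of_real (sph_harm (fst p) (snd p) (khat k)))" for k
      by (simp add: c basis_fn_def sum_distrib_left mult_ac)
  qed
qed

lemma Vspace_diff: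
  assumes "g \<in> Vspace i" "h \<in> Vspace i"
  shows "(\<lambda>k. g k - h k) \<in> Vspace i"
proof -
  obtain c d where "g = (\<lambda>k. \<Sum>p\<in>harm_idx i. c p * basis_fn i (fst p) (snd p) k)"
    "h = (\<lambda>k. \<Sum>p\<in>harm_idx i. d p * basis_fn i (fst p) (snd p) k)"
    using assms unfolding mem_Vspace_iff by blast
  then have "(\<lambda>k. g k - h k) = (\<lambda>k. \<Sum>p\<in>harm_idx i. (c p - d p) * basis_fn i (fst p) (snd p) k)"
    by (simp add: left_diff_distrib sum_subtractf)
  then show ?thesis
    unfolding mem_Vspace_iff by (rule exI[of _ "\<lambda>p. c p - d p"])
qed

text \<open>The radial factor vanishes off a closed shell, which is compact and avoids the origin,
  and on this shell the integrand is continuous.\<close>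

lemma integrable_mult_cnj_basis_fn:
  assumes "continuous_on (- {0}) g"
  shows "integrable lborel (\<lambda>k. g k * cnj (basis_fn i l m k))"
proof -
  define K where "K = cball (0::R3) (eps i) - ball 0 (eps (Suc i))"
  define p where "p = (\<lambda>k. g k * complex_of_real
    ((ln 2) powr (-1/2) * norm k powr (-3/2) * sph_harm l m (khat k)))"
  have "compact K"
    unfolding K_def by (intro compact_diff) auto
  moreover have K0: "K \<subseteq> - {0}"
    by (auto simp: K_def)
  have "continuous_on K p"
    unfolding p_def using K0
    by (intro continuous_intros continuous_on_subset[OF assms] continuous_on_subset[OF continuous_on_khat]
        continuous_on_compose2[OF continuous_on_sph_harm]) auto
  ultimately have "integrable lborel (\<lambda>k. indicator K k *\<^sub>R p k)"
    by (rule borel_integrable_compact)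
  moreover have "indicator K k *\<^sub>R p k = g k * cnj (basis_fn i l m k)" for k
    by (auto simp: p_def K_def basis_fn_def zeta_def indicator_def)
  ultimately show ?thesis by simp
qed

lemma integrable_basis_fn_mult_cnj:
  "integrable lborel (\<lambda>k. basis_fn i l m k * cnj (basis_fn i l' m' k))"
proof -
  \<comment> \<open>\<open>basis_fn\<close> jumps at the boundary of the shell. Dropping the
    indicator gives a function continuous off the origin that agrees with it wherever the other
    factor is nonzero.\<close>
  define p where "p = (\<lambda>k. complex_of_real ((ln 2) powr (-1/2) * norm k powr (-3/2) * sph_harm l m (khat k)))"
  have "continuous_on (- {0}) p"
    unfolding p_def
    by (intro continuous_intros continuous_on_khat continuous_on_compose2[OF continuous_on_sph_harm]) auto
  then have "integrable lborel (\<lambda>k. p k * cnj (basis_fn i l' m' k))"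
    by (rule integrable_mult_cnj_basis_fn)
  moreover have "p k * cnj (basis_fn i l' m' k) = basis_fn i l m k * cnj (basis_fn i l' m' k)" for k
    by (auto simp: p_def basis_fn_def zeta_def indicator_def)
  ultimately show ?thesis by simp
qed

lemma integrable_mult_cnj_Vspace:
  assumes "\<And>l m. integrable lborel (\<lambda>k. f k * cnj (basis_fn i l m k))" "h \<in> Vspace i"
  shows "integrable lborel (\<lambda>k. f k * cnj (h k))"
proof -
  obtain c where "h = (\<lambda>k. \<Sum>p\<in>harm_idx i. c p * basis_fn i (fst p) (snd p) k)"
    using assms unfolding mem_Vspace_iff by blast
  then have "f k * cnj (h k) = (\<Sum>p\<in>harm_idx i. cnj (c p) * (f k * cnj (basis_fn i (fst p) (snd p) k)))" for k
    by (simp add: sum_distrib_left mult_ac)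
  then show ?thesis
    using assms(1) by auto
qed

lemma integrable_Vspace_mult_cnj:
  assumes "g \<in> Vspace i" "h \<in> Vspace i"
  shows "integrable lborel (\<lambda>k. g k * cnj (h k))"
proof -
  have "integrable lborel (\<lambda>k. basis_fn i l m k * cnj (g k))" for l m
    using integrable_mult_cnj_Vspace[OF integrable_basis_fn_mult_cnj assms(1)] .
  then have "integrable lborel (\<lambda>k. g k * cnj (basis_fn i l m k))" for l m
    using integrable_cnj[of lborel "\<lambda>k. basis_fn i l m k * cnj (g k)"] by (simp add: mult.commute)
  then show ?thesis
    using integrable_mult_cnj_Vspace assms(2) by blast
qed

text \<open>The elements of \<^term>\<open>Vspace i\<close> are genuine functions rather than almost-everywhere classes, so
  the definite description in \<^const>\<open>Qproj\<close> needs uniqueness pointwise; it holds because they are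
  continuous on the open shell and their values elsewhere are determined by homogeneity.\<close>

lemma Vspace_eq_0:
  assumes g: "g \<in> Vspace i" and "i \<ge> 1" and "(LINT k|lborel. g k * cnj (g k)) = 0"
  shows "g = (\<lambda>_. 0)"
proof -
  obtain Y where Y: "continuous_on UNIV Y" and gY: "\<And>k. g k = complex_of_real (zeta i (norm k)) * Y (khat k)"
    using Vspace_E[OF g] by blast
  have "complex_of_real (LINT k|lborel. (cmod (g k))\<^sup>2) = 0"
    using assms(3) by (simp add: complex_norm_square[symmetric] flip: integral_complex_of_real)
  moreover have "integrable lborel (\<lambda>k. (cmod (g k))\<^sup>2)"
    using integrable_norm[OF integrable_Vspace_mult_cnj[OF g g]] by (simp add: norm_mult power2_eq_square)
  ultimately have AE: "AE k in lborel. g k = 0"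
    using integral_nonneg_eq_0_iff_AE[of lborel "\<lambda>k. (cmod (g k))\<^sup>2"] by simp
  define S where "S = ball (0::R3) (eps i) - cball 0 (eps (Suc i))"
  define W where "W = {k \<in> S. Y (khat k) \<noteq> 0}"
  have S: "k \<in> S \<longleftrightarrow> eps (Suc i) < norm k \<and> norm k < eps i" for k
    by (auto simp: S_def)
  have "open S"
    by (simp add: S_def open_Diff)
  have S0: "k \<noteq> 0" if "k \<in> S" for k
    using that eps_pos[of "Suc i"] unfolding S by (metis norm_zero less_asym)
  have "continuous_on S (\<lambda>k. Y (khat k))"
    using S0
    by (intro continuous_on_compose2[OF Y] continuous_on_subset[OF continuous_on_khat]) auto
  then have "open (S \<inter> (\<lambda>k. Y (khat k)) -` (- {0}))"
    using \<open>open S\<close> continuous_on_open_vimage by (metis Int_commute open_Compl closed_singleton)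
  then have "open W"
    by (simp add: W_def Int_def)
  have zeta0: "zeta i (norm k) \<noteq> 0" if "k \<in> S" for k
    using that S0 unfolding S by (auto simp: zeta_def indicator_def)
  have "AE k in lborel. k \<notin> W"
    using AE by eventually_elim (auto simp: W_def gY zeta0)
  with \<open>open W\<close> have "W = {}"
    by (rule AE_lborel_open_imp_empty)
  show ?thesis
  proof
    fix k
    show "g k = 0"
    proof (cases "k = 0")
      case True
      then show ?thesis
        using eps_pos[of "Suc i"] by (auto simp: gY zeta_def indicator_def)
    next
      case False
      \<comment> \<open>Rescales \<open>k\<close> to norm \<open>3/4 * eps i\<close>, halfway
        between the radii \<open>eps i / 2\<close> and \<open>eps i\<close>, without changing its
        direction.\<close>
      define c where "c = (3/4) * eps i / norm k"
      have "c > 0" using False by (simp add: c_def)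
      have "norm (c *\<^sub>R k) = (3/4) * eps i"
        using False by (simp add: c_def abs_mult abs_of_pos)
      then have "c *\<^sub>R k \<in> S"
        using eps_Suc[OF \<open>i \<ge> 1\<close>] eps_pos[of i] unfolding S by linarith
      then have "Y (khat (c *\<^sub>R k)) = 0"
        using \<open>W = {}\<close> by (auto simp: W_def)
      then show ?thesis
        by (simp add: gY khat_scaleR[OF \<open>c > 0\<close>])
    qed
  qed
qed

text \<open>Shows that the definite description denotes. Orthogonality to the basis functions yields
  a candidate, and the difference of two candidates is orthogonal to itself, hence identically 0.
  Membership in \<open>Vspace i\<close> is all that is recorded, because the later lower bound holds
  for every angular term.\<close>

lemma Qproj_in_Vspace:
  assumes "i \<ge> 1" and f: "\<And>l m. integrable lborel (\<lambda>k. f k * cnj (basis_fn i l m k))"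
  shows "Qproj i f \<in> Vspace i"
proof -
  define P where "P = (\<lambda>g. g \<in> Vspace i \<and>
      (\<forall>h\<in>Vspace i. (LINT k|lborel. (f k - g k) * cnj (h k)) = 0))"
  have int_fh: "integrable lborel (\<lambda>k. f k * cnj (h k))" if "h \<in> Vspace i" for h
    using integrable_mult_cnj_Vspace[OF f that] .
  have "\<exists>c. \<forall>j\<in>harm_idx i. (LINT k|lborel. (f k - (\<Sum>p\<in>harm_idx i. c p * basis_fn i (fst p) (snd p) k)) *
      cnj (basis_fn i (fst j) (snd j) k)) = 0"
    by (rule ex_orthogonal_projection[OF finite_harm_idx]) (auto intro: f integrable_basis_fn_mult_cnj)
  then obtain c where c: "\<And>j. j\<in>harm_idx i \<Longrightarrow>
      (LINT k|lborel. (f k - (\<Sum>p\<in>harm_idx i. c p * basis_fn i (fst p) (snd p) k)) *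
      cnj (basis_fn i (fst j) (snd j) k)) = 0"
    by blast
  define g where "g = (\<lambda>k. \<Sum>p\<in>harm_idx i. c p * basis_fn i (fst p) (snd p) k)"
  have gV: "g \<in> Vspace i"
    unfolding g_def mem_Vspace_iff by blast
  have g_basis: "integrable lborel (\<lambda>k. (f k - g k) * cnj (basis_fn i l m k))" for l m
  proof -
    have "integrable lborel (\<lambda>k. g k * cnj (basis_fn i l m k))"
      unfolding g_def sum_distrib_right mult.assoc
      by (auto intro!: integrable_basis_fn_mult_cnj)
    then show ?thesis
      using f by (auto simp: left_diff_distrib)
  qed
  have "(LINT k|lborel. (f k - g k) * cnj (h k)) = 0" if h: "h \<in> Vspace i" for h
  proof -
    obtain d where "h = (\<lambda>k. \<Sum>p\<in>harm_idx i. d p * basis_fn i (fst p) (snd p) k)"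
      using h unfolding mem_Vspace_iff by blast
    then have "(f k - g k) * cnj (h k) =
      (\<Sum>p\<in>harm_idx i. cnj (d p) * ((f k - g k) * cnj (basis_fn i (fst p) (snd p) k)))" for k
      by (simp add: sum_distrib_left mult_ac)
    then have "(LINT k|lborel. (f k - g k) * cnj (h k)) = (\<Sum>p\<in>harm_idx i. cnj (d p) *
        (LINT k|lborel. (f k - g k) * cnj (basis_fn i (fst p) (snd p) k)))"
      using g_basis by (simp add: integral_sum)
    also have "\<dots> = 0"
      using c by (intro sum.neutral) (auto simp: g_def)
    finally show ?thesis .
  qed
  then have "P g"
    using gV by (simp add: P_def)
  moreover have "g' = g" if "P g'" for g'
  proof -
    define h where "h = (\<lambda>k. g' k - g k)"
    have g'V: "g' \<in> Vspace i"
      using that by (simp add: P_def)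
    have h: "h \<in> Vspace i"
      unfolding h_def using g'V gV by (rule Vspace_diff)
    have int: "integrable lborel (\<lambda>k. (f k - g k) * cnj (h k))"
        "integrable lborel (\<lambda>k. (f k - g' k) * cnj (h k))"
      using int_fh[OF h] integrable_Vspace_mult_cnj[OF g'V h] integrable_Vspace_mult_cnj[OF gV h]
      by (auto simp: left_diff_distrib)
    have "h k * cnj (h k) = (f k - g k) * cnj (h k) - (f k - g' k) * cnj (h k)" for k
      by (simp add: h_def algebra_simps)
    then have "(LINT k|lborel. h k * cnj (h k)) =
        (LINT k|lborel. (f k - g k) * cnj (h k)) - (LINT k|lborel. (f k - g' k) * cnj (h k))"
      using int by simp
    also have "\<dots> = 0"
      using \<open>P g\<close> that h by (simp add: P_def)
    finally show ?thesis
      using Vspace_eq_0[OF h \<open>i \<ge> 1\<close>] by (auto simp: h_def fun_eq_iff)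
  qed
  ultimately have "P (THE g. P g)"
    by (rule theI)
  then show ?thesis
    by (simp add: P_def Qproj_def)
qed

subsection \<open>The contribution of a single shell\<close>

text \<open>Factoring out \<open>cis s\<close> leaves \<open>cis (t - s) - 1\<close>, whose
  imaginary part is \<open>sin (t - s)\<close>, and the sine increases on this range.\<close>

lemma norm_cis_diff_ge:
  assumes "1/4 \<le> t - s" "t - s \<le> 1/2"
  shows "sin (1/4) \<le> cmod (cis s - cis t)"
proof -
  have "cis t - cis s = cis s * (cis (t - s) - 1)"
    by (simp add: right_diff_distrib cis_mult)
  then have "cmod (cis s - cis t) = cmod (cis (t - s) - 1)"
    by (metis norm_minus_commute norm_mult norm_cis mult_1)
  also have "\<dots> \<ge> \<bar>Im (cis (t - s) - 1)\<bar>"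
    by (rule abs_Im_le_cmod)
  finally have "sin (t - s) \<le> cmod (cis s - cis t)" by simp
  moreover have "sin (1/4) \<le> sin (t - s)"
    using assms pi_gt3 by (intro sin_monotone_2pi_le) auto
  ultimately show ?thesis by linarith
qed

text \<open>A common shift \<open>z\<close> cannot make both vectors small when \<open>p\<close> and
  \<open>q\<close> are apart: triangle inequality, then the bound of a squared sum by twice the sum
  of squares.\<close>

lemma parallelogram_lower_bound:
  fixes p q z :: "'a::real_inner"
  shows "(norm (p - q))\<^sup>2 / 2 \<le> (norm (p + z))\<^sup>2 + (norm (q + z))\<^sup>2"
proof -
  have "norm (p - q) \<le> norm (p + z) + norm (q + z)"
    using norm_triangle_ineq4[of "p + z" "q + z"] by simp
  then have "(norm (p - q))\<^sup>2 \<le> (norm (p + z) + norm (q + z))\<^sup>2"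
    by (intro power_mono) auto
  also have "\<dots> \<le> 2 * ((norm (p + z))\<^sup>2 + (norm (q + z))\<^sup>2)"
    using sum_squares_bound[of "norm (p + z)" "norm (q + z)"] by (simp add: power2_sum)
  finally show ?thesis by simp
qed

text \<open>The purely angular term \<open>z\<close> takes the same value at \<open>k\<close> and at \<open>lam k\<close>, so it cancels when
  the integrand is compared at these two points, while for
  \<open>lam = 1 + 1/(2 t e)\<close> the phase of \<open>cis (t |k|)\<close> changes by \<open>|k|/(2 e)\<close>, which lies
  between 1/4 and 1/2 on the shell.\<close>

lemma shell_lower_bound:
  fixes a F z :: "R3 \<Rightarrow> complex" and e t :: real
  assumes [measurable]: "a \<in> borel_measurable borel" "F \<in> borel_measurable borel" "z \<in> borel_measurable borel"
    and "e > 0" and te: "t * e \<ge> 1"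
    and near: "\<And>k. norm k < e \<Longrightarrow> cmod (a k - a0) \<le> cmod a0 * sin (1/4) / 4"
    and F: "\<And>c k. c > 0 \<Longrightarrow> F (c *\<^sub>R k) = F k"
    and z: "\<And>c k. c > 0 \<Longrightarrow> z (c *\<^sub>R k) = z k"
  shows "ennreal ((cmod a0 * sin (1/4) / 2)\<^sup>2 / 2) *
      (\<integral>\<^sup>+k. ennreal ((cmod (F k))\<^sup>2 / norm k ^ 3) * indicator {k. 1/2 < norm k \<and> norm k < 2/3} k \<partial>lborel)
    \<le> 2 * (\<integral>\<^sup>+k. ennreal ((cmod (cis (t * norm k) * a k * F k + z k))\<^sup>2 / norm k ^ 3)
        * indicator {k. e / 2 < norm k \<and> norm k < e} k \<partial>lborel)"
    (is "?C * (\<integral>\<^sup>+k. ?G k * indicator ?A1 k \<partial>lborel) \<le> 2 * ?J")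
proof -
  have [measurable]: "cis \<in> borel_measurable borel"
    by (intro borel_measurable_continuous_onI continuous_intros)
  define p where "p = (\<lambda>k. cis (t * norm k) * a k)"
  define H where "H = (\<lambda>k. (cmod (p k * F k + z k))\<^sup>2 / norm k ^ 3)"
  define U where "U = {k::R3. e / 2 < norm k \<and> norm k < e}"
  \<comment> \<open>The factor 2/3 keeps \<open>lam *\<^sub>R k\<close> inside the shell
    \<open>U\<close>, as \<open>lam\<close> is at most 3/2 by \<open>t * e \<ge> 1\<close>.\<close>
  define A where "A = {k::R3. e / 2 < norm k \<and> norm k < 2 / 3 * e}"
  \<comment> \<open>The phase change contributes \<open>cmod a0 * sin (1/4)\<close>; replacing
    \<open>a\<close> by \<open>a0\<close> at the two points costs a quarter of this each, so half
    remains.\<close>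
  define \<kappa> where "\<kappa> = cmod a0 * sin (1/4) / 2"
  define lam where "lam = 1 + 1 / (2 * (t * e))"
  have [measurable]: "p \<in> borel_measurable borel"
    unfolding p_def by measurable
  have [measurable]: "H \<in> borel_measurable borel"
    unfolding H_def by measurable
  have [measurable]: "U \<in> sets borel" "A \<in> sets borel"
    unfolding U_def A_def by measurable
  have lam: "1 < lam" "lam \<le> 3 / 2"
    using te by (auto simp: lam_def field_simps)
  have "sin (1/4 :: real) > 0"
    using pi_gt3 by (intro sin_gt_zero) auto
  then have \<kappa>0: "\<kappa> \<ge> 0"
    by (simp add: \<kappa>_def)
  have phase: "\<kappa> \<le> cmod (p k - p (lam *\<^sub>R k))" if "k \<in> A" for k
  proof -
    define c where "c = cis (t * norm k)"
    define c' where "c' = cis (t * norm (lam *\<^sub>R k))"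
    have k: "e / 2 < norm k" "norm k < 2 / 3 * e"
      using that by (auto simp: A_def)
    have "lam * norm k < e"
    proof -
      have "lam * norm k \<le> 3 / 2 * norm k"
        using lam by (intro mult_right_mono) auto
      then show ?thesis using k by linarith
    qed
    then have near': "cmod (a k - a0) \<le> cmod a0 * sin (1/4) / 4"
        "cmod (a (lam *\<^sub>R k) - a0) \<le> cmod a0 * sin (1/4) / 4"
      using lam k \<open>e > 0\<close> by (intro near; simp)+
    have norm_lam: "norm (lam *\<^sub>R k) = lam * norm k"
      using lam by simp
    have "t \<noteq> 0" using te by auto
    then have "t * norm (lam *\<^sub>R k) - t * norm k = norm k / (2 * e)"
      using norm_lam \<open>e > 0\<close> by (simp add: lam_def field_simps)
    moreover have "1/4 \<le> norm k / (2 * e)" "norm k / (2 * e) \<le> 1/2"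
      using k \<open>e > 0\<close> by (auto simp: field_simps)
    ultimately have "sin (1/4) \<le> cmod (c - c')"
      unfolding c_def c'_def by (intro norm_cis_diff_ge) auto
    then have "sin (1/4) * cmod a0 \<le> cmod ((c - c') * a0)"
      unfolding norm_mult by (intro mult_right_mono) auto
    also have "(c - c') * a0 = (p k - p (lam *\<^sub>R k)) - (c * (a k - a0) - c' * (a (lam *\<^sub>R k) - a0))"
      by (simp add: p_def c_def c'_def algebra_simps)
    also have "cmod \<dots> \<le> cmod (p k - p (lam *\<^sub>R k)) + (cmod (c * (a k - a0)) + cmod (c' * (a (lam *\<^sub>R k) - a0)))"
      by (meson add_left_mono norm_triangle_ineq4 order_trans)
    also have "\<dots> = cmod (p k - p (lam *\<^sub>R k)) + (cmod (a k - a0) + cmod (a (lam *\<^sub>R k) - a0))"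
      by (simp add: norm_mult c_def c'_def)
    finally show ?thesis
      using near' by (simp add: \<kappa>_def algebra_simps)
  qed
  \<comment> \<open>The factor \<open>lam ^ 3\<close> offsets the change of
    \<open>norm k ^ 3\<close> in the denominator and is also the Jacobian of the scaling, so each
    summand on the right integrates to at most the integral over \<open>U\<close>.\<close>
  have pointwise: "\<kappa>\<^sup>2 / 2 * ((cmod (F k))\<^sup>2 / norm k ^ 3) \<le> H k + lam ^ 3 * H (lam *\<^sub>R k)" if "k \<in> A" for k
  proof -
    have "k \<noteq> 0"
      using that \<open>e > 0\<close> by (auto simp: A_def)
    have "\<kappa>\<^sup>2 * (cmod (F k))\<^sup>2 \<le> (cmod (p k - p (lam *\<^sub>R k)))\<^sup>2 * (cmod (F k))\<^sup>2"
      using phase[OF that] \<kappa>0 by (intro mult_right_mono power_mono) auto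
    also have "\<dots> = (cmod (p k * F k - p (lam *\<^sub>R k) * F k))\<^sup>2"
      by (simp add: norm_mult power_mult_distrib flip: left_diff_distrib)
    finally have "\<kappa>\<^sup>2 * (cmod (F k))\<^sup>2 / 2 \<le> (cmod (p k * F k + z k))\<^sup>2 + (cmod (p (lam *\<^sub>R k) * F k + z k))\<^sup>2"
      using parallelogram_lower_bound[of "p k * F k" "p (lam *\<^sub>R k) * F k" "z k"] by linarith
    then have "\<kappa>\<^sup>2 * (cmod (F k))\<^sup>2 / 2 / norm k ^ 3 \<le>
        ((cmod (p k * F k + z k))\<^sup>2 + (cmod (p (lam *\<^sub>R k) * F k + z k))\<^sup>2) / norm k ^ 3"
      by (intro divide_right_mono) auto
    also have "\<dots> = H k + lam ^ 3 * H (lam *\<^sub>R k)"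
      using lam \<open>k \<noteq> 0\<close> by (simp add: H_def F z add_divide_distrib power_mult_distrib)
    finally show ?thesis by simp
  qed
  have J: "?J = (\<integral>\<^sup>+k. ennreal (H k) * indicator U k \<partial>lborel)"
    by (simp add: H_def U_def p_def)
  have scaled: "?J = (\<integral>\<^sup>+k. ennreal (lam ^ 3) * (ennreal (H (lam *\<^sub>R k)) * indicator U (lam *\<^sub>R k)) \<partial>lborel)"
  proof -
    have "(\<lambda>k. ennreal (H k) * indicator U k) \<in> borel_measurable borel"
      by measurable
    from nn_integral_lborel_scale[OF this, of lam] show ?thesis
      unfolding J using lam by simp
  qed
  \<comment> \<open>Scale invariance of the measure with density \<open>1 / norm k ^ 3\<close>: the
    integral over \<open>A\<close> does not depend on \<open>e\<close>, which makes the bound the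
    same for all shells.\<close>
  have "(\<integral>\<^sup>+k. ?G k * indicator ?A1 k \<partial>lborel) = (\<integral>\<^sup>+k. ?G k * indicator A k \<partial>lborel)"
  proof -
    have DIM3: "DIM(R3) = 3" by simp
    have "(\<lambda>k. ?G k * indicator A k) \<in> borel_measurable borel"
      by measurable
    from nn_integral_lborel_scale[OF this \<open>e > 0\<close>]
    have "(\<integral>\<^sup>+k. ?G k * indicator A k \<partial>lborel) =
        (\<integral>\<^sup>+k. ennreal (e ^ 3) * (?G (e *\<^sub>R k) * indicator A (e *\<^sub>R k)) \<partial>lborel)"
      by (simp only: DIM3)
    also have "\<dots> = (\<integral>\<^sup>+k. ?G k * indicator ?A1 k \<partial>lborel)"
    proof (rule nn_integral_cong)
      fix k :: R3
      have "indicator A (e *\<^sub>R k) = (indicator ?A1 k :: ennreal)"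
        using \<open>e > 0\<close> by (auto simp: A_def indicator_def)
      moreover have "ennreal (e ^ 3) * ?G (e *\<^sub>R k) = ?G k"
        using \<open>e > 0\<close> by (simp add: F power_mult_distrib flip: ennreal_mult)
      ultimately show "ennreal (e ^ 3) * (?G (e *\<^sub>R k) * indicator A (e *\<^sub>R k)) = ?G k * indicator ?A1 k"
        by (simp only: mult.assoc[symmetric])
    qed
    finally show ?thesis by simp
  qed
  then have "?C * (\<integral>\<^sup>+k. ?G k * indicator ?A1 k \<partial>lborel) = (\<integral>\<^sup>+k. ennreal (\<kappa>\<^sup>2 / 2) * (?G k * indicator A k) \<partial>lborel)"
    by (simp add: nn_integral_cmult \<kappa>_def)
  also have "\<dots> \<le> (\<integral>\<^sup>+k. ennreal (H k) * indicator U k +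
      ennreal (lam ^ 3) * (ennreal (H (lam *\<^sub>R k)) * indicator U (lam *\<^sub>R k)) \<partial>lborel)"
  proof (rule nn_integral_mono)
    fix k :: R3
    show "ennreal (\<kappa>\<^sup>2 / 2) * (?G k * indicator A k) \<le> ennreal (H k) * indicator U k +
      ennreal (lam ^ 3) * (ennreal (H (lam *\<^sub>R k)) * indicator U (lam *\<^sub>R k))"
    proof (cases "k \<in> A")
      case True
      have "lam * norm k \<le> 3 / 2 * norm k" "1 * norm k \<le> lam * norm k"
        using lam by (intro mult_right_mono; simp)+
      then have "k \<in> U" "lam *\<^sub>R k \<in> U"
        using True lam by (auto simp: A_def U_def)
      have "0 \<le> H k" "0 \<le> H (lam *\<^sub>R k)"
        by (simp_all add: H_def)
      then have "ennreal (H k + lam ^ 3 * H (lam *\<^sub>R k)) = ennreal (H k) + ennreal (lam ^ 3) * ennreal (H (lam *\<^sub>R k))"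
        using lam by (simp add: ennreal_mult)
      moreover have "ennreal (\<kappa>\<^sup>2 / 2) * ?G k = ennreal (\<kappa>\<^sup>2 / 2 * ((cmod (F k))\<^sup>2 / norm k ^ 3))"
        by (rule ennreal_mult[symmetric]) auto
      ultimately have "ennreal (\<kappa>\<^sup>2 / 2) * ?G k \<le> ennreal (H k) + ennreal (lam ^ 3) * ennreal (H (lam *\<^sub>R k))"
        using ennreal_leI[OF pointwise[OF True]] by metis
      with True \<open>k \<in> U\<close> \<open>lam *\<^sub>R k \<in> U\<close> show ?thesis
        by simp
    qed simp
  qed
  also have "\<dots> = ?J + ?J"
    by (subst nn_integral_add) (measurable, simp only: J[symmetric] scaled[symmetric])
  finally show ?thesis
    by (simp add: mult_2)
qed

section \<open>The operator \<open>T_op\<close> on one open shell\<close>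

lemma zeta_eq_0_on_other_shell:
  assumes "eps (Suc i) < t" "t < eps i" "j \<noteq> i"
  shows "zeta j t = 0"
proof (cases "j < i")
  case True
  then have "eps i \<le> eps (Suc j)" by (intro eps_antimono) simp
  then show ?thesis using assms by (simp add: zeta_def)
next
  case False
  then have "eps j \<le> eps (Suc i)" using assms(3) by (intro eps_antimono) simp
  then show ?thesis using assms by (simp add: zeta_def)
qed

text \<open>The phase \<open>cis (tau r i * norm k)\<close> undoes \<open>u_op (- tau r i)\<close>,
  so the projected terms reduce to \<open>norm k powr (-3/2)\<close> times a function of direction.
  The integrability assumptions place every projection in its \<open>Vspace\<close>.\<close>

lemma T_op_on_shell:
  assumes "i \<ge> 1"
    and Re: "\<And>i s l m. integrable lborel (\<lambda>k. complex_of_real (Re (u_op s f k)) * cnj (basis_fn i l m k))"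
    and Im: "\<And>i s l m. integrable lborel (\<lambda>k. complex_of_real (Im (u_op s f k)) * cnj (basis_fn i l m k))"
  obtains z where "continuous_on UNIV z"
    "\<And>k. eps (Suc i) < norm k \<Longrightarrow> norm k < eps i \<Longrightarrow>
      cis (tau r i * norm k) * T_op r f k =
      cis (tau r i * norm k) * f k + complex_of_real (norm k powr (-3/2)) * z (khat k)"
proof -
  define A where "A = (\<lambda>j. Qproj j (\<lambda>k. complex_of_real (Re (u_op (tau r j) f k))))"
  define B where "B = (\<lambda>j. Qproj j (\<lambda>k. complex_of_real (Im (u_op (tau r j) f k))))"
  have A_V: "A j \<in> Vspace j" and B_V: "B j \<in> Vspace j" if "j \<ge> 1" for j
    unfolding A_def B_def using that Re Im by (auto intro!: Qproj_in_Vspace)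
  obtain YA where YA: "continuous_on UNIV YA" "\<And>k. A i k = complex_of_real (zeta i (norm k)) * YA (khat k)"
    using Vspace_E[OF A_V[OF \<open>i \<ge> 1\<close>]] by blast
  obtain YB where YB: "continuous_on UNIV YB" "\<And>k. B i k = complex_of_real (zeta i (norm k)) * YB (khat k)"
    using Vspace_E[OF B_V[OF \<open>i \<ge> 1\<close>]] by blast
  define z where "z = (\<lambda>w. complex_of_real ((ln 2) powr (-1/2)) *
    (complex_of_real (1 / bcoef i - 1) * YA w + \<i> * (complex_of_real (bcoef i - 1) * YB w)))"
  show thesis
  proof
    show "continuous_on UNIV z"
      unfolding z_def by (intro continuous_intros YA YB)
    fix k :: R3
    assume k: "eps (Suc i) < norm k" "norm k < eps i"
    have "A j k = 0" "B j k = 0" if "j \<ge> 1" "j \<noteq> i" for j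
      using Vspace_E[OF A_V[OF that(1)]] Vspace_E[OF B_V[OF that(1)]]
        zeta_eq_0_on_other_shell[OF k that(2)] by (metis mult_zero_left of_real_0)+
    then have off: "\<forall>j\<ge>1. j \<noteq> i \<longrightarrow> A j k = 0" "\<forall>j\<ge>1. j \<noteq> i \<longrightarrow> B j k = 0"
      by blast+
    \<comment> \<open>The series runs over \<open>n\<close> with shell index \<open>Suc n\<close>,
      so the only surviving term is \<open>n = i - 1\<close>.\<close>
    have single: "(\<Sum>n. complex_of_real (c (Suc n)) * u_op (s (Suc n)) (X (Suc n)) k) =
        complex_of_real (c i) * u_op (s i) (X i) k"
      if X: "\<forall>j\<ge>1. j \<noteq> i \<longrightarrow> X j k = 0" for c s X
    proof -
      have "(\<Sum>n. complex_of_real (c (Suc n)) * u_op (s (Suc n)) (X (Suc n)) k) =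
          (\<Sum>n\<in>{i - 1}. complex_of_real (c (Suc n)) * u_op (s (Suc n)) (X (Suc n)) k)"
      proof (rule suminf_finite)
        fix n assume "n \<notin> {i - 1}"
        then have "Suc n \<noteq> i" by auto
        then show "complex_of_real (c (Suc n)) * u_op (s (Suc n)) (X (Suc n)) k = 0"
          using X by (simp add: u_op_def)
      qed simp
      then show ?thesis using \<open>i \<ge> 1\<close> by simp
    qed
    have "T_op r f k = f k + complex_of_real (1 / bcoef i - 1) * u_op (- tau r i) (A i) k
        + \<i> * (complex_of_real (bcoef i - 1) * u_op (- tau r i) (B i) k)"
      unfolding T_op_def Let_def
      using single[of A "\<lambda>i. 1 / bcoef i - 1" "\<lambda>i. - tau r i", OF off(1)]
        single[of B "\<lambda>i. bcoef i - 1" "\<lambda>i. - tau r i", OF off(2)]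
      by (simp only: A_def B_def)
    also have "\<dots> = f k + cis (- (tau r i * norm k)) *
        (complex_of_real (1 / bcoef i - 1) * A i k + \<i> * (complex_of_real (bcoef i - 1) * B i k))"
      by (simp add: u_op_def algebra_simps)
    finally have "cis (tau r i * norm k) * T_op r f k = cis (tau r i * norm k) * f k +
        (cis (tau r i * norm k) * cis (- (tau r i * norm k))) *
        (complex_of_real (1 / bcoef i - 1) * A i k + \<i> * (complex_of_real (bcoef i - 1) * B i k))"
      by (simp only: distrib_left mult.assoc)
    moreover have "zeta i (norm k) = (ln 2) powr (-1/2) * norm k powr (-3/2)"
      using k by (simp add: zeta_def)
    ultimately show "cis (tau r i * norm k) * T_op r f k =
      cis (tau r i * norm k) * f k + complex_of_real (norm k powr (-3/2)) * z (khat k)"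
      by (simp add: cis_mult YA(2) YB(2) z_def algebra_simps)
  qed
qed

section \<open>The difference of the two cut-off functions\<close>

lemma inner_khat_less_1:
  assumes "norm v < 1"
  shows "khat k \<bullet> v < 1"
proof -
  have "norm (khat k) \<le> 1"
    by (cases "k = 0") (simp_all add: khat_def)
  have "khat k \<bullet> v \<le> norm (khat k) * norm v"
    by (rule norm_cauchy_schwarz)
  also have "\<dots> \<le> 1 * norm v"
    using \<open>norm (khat k) \<le> 1\<close> by (intro mult_right_mono) auto
  finally show ?thesis using assms by simp
qed

text \<open>The product is \<open>eps i powr r\<close>, a nonpositive power of a number in (0, 1].
  This is where the sign of \<open>r\<close> enters.\<close>

lemma tau_mult_eps_ge_1:
  assumes "r \<le> 0"
  shows "tau r i * eps i \<ge> 1"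
proof -
  have "eps i \<le> 1"
    by (simp add: eps_def power_le_one)
  then have "eps i powr 0 \<le> eps i powr r"
    using assms by (intro powr_mono') (auto simp: less_imp_le)
  moreover have "eps i powr r = tau r i * eps i"
    by (simp add: tau_def powr_diff abs_of_pos)
  ultimately show ?thesis
    using eps_pos[of i] by (metis powr_zero_eq_one less_numeral_extra(3))
qed

text \<open>The angular profile of the difference, written as a function of \<open>k\<close> that is
  invariant under positive scaling, in the role of \<open>F\<close> in
  \<open>shell_lower_bound\<close>.\<close>

definition ang_diff :: "R3 \<Rightarrow> R3 \<Rightarrow> R3 \<Rightarrow> complex" where
  "ang_diff v w k = complex_of_real (1 / (1 - khat k \<bullet> v) - 1 / (1 - khat k \<bullet> w))"

lemma measurable_ang_diff [measurable]: "ang_diff v w \<in> borel_measurable borel"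
  unfolding ang_diff_def by measurable

lemma gfun_diff:
  "gfun j v k - gfun j w k =
    complex_of_real (norm k powr (-3/2)) * (\<i> * fourier3 j k * ang_diff v w k)"
  by (simp add: gfun_def ang_diff_def algebra_simps)

lemma gcut_diff:
  "gcut j v \<sigma> k - gcut j w \<sigma> k = complex_of_real (indicator {\<sigma>..} (norm k)) * (gfun j v k - gfun j w k)"
  by (simp add: gcut_def algebra_simps)

text \<open>\<open>\<phi>\<close> stands for \<open>Re\<close> or \<open>Im\<close>. Its homogeneity
  gives \<open>\<phi> 0 = 0\<close>, which settles the points below the cutoff; above it the
  function is continuous off the origin.\<close>

lemma integrable_gcut_diff:
  assumes j: "integrable lborel j" and v: "norm v < 1" and w: "norm w < 1"
    and \<phi>: "continuous_on UNIV \<phi>" "\<And>c x. \<phi> (complex_of_real c * x) = c * \<phi> x"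
  shows "integrable lborel (\<lambda>k. complex_of_real (\<phi> (u_op s (\<lambda>k. gcut j v \<sigma> k - gcut j w \<sigma> k) k))
    * cnj (basis_fn i l m k))"
proof -
  define D where "D = (\<lambda>k. complex_of_real (\<phi> (cis (norm k * s) * (gfun j v k - gfun j w k))))"
  have "1 - khat k \<bullet> v \<noteq> 0" "1 - khat k \<bullet> w \<noteq> 0" for k
    using inner_khat_less_1[OF v, of k] inner_khat_less_1[OF w, of k] by auto
  then have "continuous_on (- {0}) (\<lambda>k. gfun j v k - gfun j w k)"
    unfolding gfun_def
    by (intro continuous_intros continuous_on_khat continuous_on_subset[OF continuous_fourier3[OF j]]) auto
  then have "continuous_on (- {0}) D"
    unfolding D_def
    by (intro continuous_on_of_real continuous_on_compose2[OF \<phi>(1)] continuous_on_mult)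
      (auto intro!: continuous_intros)
  then have "integrable lborel (\<lambda>k. indicator {k. \<sigma> \<le> norm k} k *\<^sub>R (D k * cnj (basis_fn i l m k)))"
    by (intro integrable_mult_indicator integrable_mult_cnj_basis_fn) auto
  moreover have "indicator {k. \<sigma> \<le> norm k} k *\<^sub>R (D k * cnj (basis_fn i l m k)) =
      complex_of_real (\<phi> (u_op s (\<lambda>k. gcut j v \<sigma> k - gcut j w \<sigma> k) k)) * cnj (basis_fn i l m k)" for k
    using \<phi>(2)[of 0 0] by (auto simp: D_def u_op_def gcut_diff indicator_def)
  ultimately show ?thesis by simp
qed

text \<open>Open, so that distinct shells are disjoint and only one projection acts on each.\<close>

definition shell :: "nat \<Rightarrow> R3 set" where
  "shell i = {k. eps (Suc i) < norm k \<and> norm k < eps i}"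

lemma measurable_shell [measurable]: "shell i \<in> sets borel"
  unfolding shell_def by measurable

lemma disjoint_family_shell: "disjoint_family_on shell I"
proof -
  have "shell i \<inter> shell j = {}" if "i < j" for i j
    using eps_antimono[of "Suc i" j] that by (force simp: shell_def)
  then show ?thesis
    unfolding disjoint_family_on_def by (metis Int_commute linorder_neqE_nat)
qed

text \<open>Instance of \<open>shell_lower_bound\<close> with \<open>e = eps i\<close> and
  \<open>t = tau r i\<close>. The left side of the bound depends neither on \<open>i\<close> nor on
  \<open>\<sigma>\<close>. Measurability on the shell is recorded so that shell integrals can be
  added.\<close>

lemma T_op_shell_lower_bound:
  assumes "r \<le> 0" and j: "integrable lborel j" and v: "norm v < 1" and w: "norm w < 1"
    and "i \<ge> 1" and \<sigma>: "\<sigma> \<le> eps (Suc i)"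
    and near: "\<And>k. norm k < eps i \<Longrightarrow> cmod (fourier3 j k - fourier3 j 0) \<le> cmod (fourier3 j 0) * sin (1/4) / 4"
  defines "f \<equiv> \<lambda>k. gcut j v \<sigma> k - gcut j w \<sigma> k"
  shows "(\<lambda>k. ennreal ((cmod (T_op r f k))\<^sup>2) * indicator (shell i) k) \<in> borel_measurable borel" (is ?M)
    and "ennreal ((cmod (fourier3 j 0) * sin (1/4) / 2)\<^sup>2 / 2) *
      (\<integral>\<^sup>+k. ennreal ((cmod (ang_diff v w k))\<^sup>2 / norm k ^ 3) * indicator {k. 1/2 < norm k \<and> norm k < 2/3} k \<partial>lborel)
    \<le> 2 * (\<integral>\<^sup>+k. ennreal ((cmod (T_op r f k))\<^sup>2) * indicator (shell i) k \<partial>lborel)" (is ?B)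
proof -
  have [measurable]: "cis \<in> borel_measurable borel"
    by (intro borel_measurable_continuous_onI continuous_intros)
  have four_meas [measurable]: "fourier3 j \<in> borel_measurable borel"
    by (rule borel_measurable_continuous_onI[OF continuous_fourier3[OF j]])
  obtain z where z: "continuous_on UNIV z" and Tz: "\<And>k. eps (Suc i) < norm k \<Longrightarrow> norm k < eps i \<Longrightarrow>
      cis (tau r i * norm k) * T_op r f k =
      cis (tau r i * norm k) * f k + complex_of_real (norm k powr (-3/2)) * z (khat k)"
  proof (rule T_op_on_shell[OF \<open>i \<ge> 1\<close>])
    show "integrable lborel (\<lambda>k. complex_of_real (Re (u_op s f k)) * cnj (basis_fn i l m k))" for i s l m
      unfolding f_def by (rule integrable_gcut_diff[OF j v w]) (auto intro!: continuous_intros)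
    show "integrable lborel (\<lambda>k. complex_of_real (Im (u_op s f k)) * cnj (basis_fn i l m k))" for i s l m
      unfolding f_def by (rule integrable_gcut_diff[OF j v w]) (auto intro!: continuous_intros)
  qed (use that in blast)
  have [measurable]: "z \<in> borel_measurable borel"
    by (rule borel_measurable_continuous_onI[OF z])
  define h where "h = (\<lambda>k. ennreal ((cmod (cis (tau r i * norm k) * (\<i> * fourier3 j k) * ang_diff v w k
    + z (khat k)))\<^sup>2 / norm k ^ 3) * indicator {k. eps i / 2 < norm k \<and> norm k < eps i} k)"
  have eq: "(\<lambda>k. ennreal ((cmod (T_op r f k))\<^sup>2) * indicator (shell i) k) = h"
  proof
    fix k
    show "ennreal ((cmod (T_op r f k))\<^sup>2) * indicator (shell i) k = h k"
    proof (cases "k \<in> shell i")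
      case True
      then have k: "eps (Suc i) < norm k" "norm k < eps i"
        by (auto simp: shell_def)
      have "norm k > 0"
        using k eps_pos less_trans by blast
      \<comment> \<open>The cutoff is inactive here, since
        \<open>\<sigma> \<le> eps (Suc i) < norm k\<close>.\<close>
      have "f k = complex_of_real (norm k powr (-3/2)) * (\<i> * fourier3 j k * ang_diff v w k)"
        using k \<sigma> by (simp add: f_def gcut_diff gfun_diff)
      with Tz[OF k] have "cis (tau r i * norm k) * T_op r f k = complex_of_real (norm k powr (-3/2)) *
          (cis (tau r i * norm k) * (\<i> * fourier3 j k) * ang_diff v w k + z (khat k))"
        by (simp add: algebra_simps)
      then have "cmod (T_op r f k) = norm k powr (-3/2) *
          cmod (cis (tau r i * norm k) * (\<i> * fourier3 j k) * ang_diff v w k + z (khat k))"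
        by (metis norm_mult norm_cis mult_1 norm_of_real abs_of_nonneg powr_ge_zero)
      moreover have "(norm k powr (-3/2))\<^sup>2 = 1 / norm k ^ 3"
      proof -
        have "(norm k powr (-3/2))\<^sup>2 = norm k powr (- 3)"
          by (simp add: power2_eq_square flip: powr_add)
        also have "\<dots> = 1 / norm k ^ 3"
          using \<open>norm k > 0\<close> by (simp add: powr_minus_divide)
        finally show ?thesis .
      qed
      ultimately show ?thesis
        using True by (simp add: h_def shell_def power_mult_distrib eps_Suc[OF \<open>i \<ge> 1\<close>])
    next
      case False
      then show ?thesis
        by (simp add: h_def shell_def eps_Suc[OF \<open>i \<ge> 1\<close>])
    qed
  qed
  show ?M
    unfolding eq h_def by measurable
  have "ennreal ((cmod (\<i> * fourier3 j 0) * sin (1/4) / 2)\<^sup>2 / 2) *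
      (\<integral>\<^sup>+k. ennreal ((cmod (ang_diff v w k))\<^sup>2 / norm k ^ 3) * indicator {k. 1/2 < norm k \<and> norm k < 2/3} k \<partial>lborel)
    \<le> 2 * (\<integral>\<^sup>+k. h k \<partial>lborel)"
    unfolding h_def
  proof (rule shell_lower_bound)
    show "cmod (\<i> * fourier3 j k - \<i> * fourier3 j 0) \<le> cmod (\<i> * fourier3 j 0) * sin (1/4) / 4"
      if "norm k < eps i" for k
      using near[OF that] by (simp add: norm_mult flip: right_diff_distrib)
  qed (simp_all add: tau_mult_eps_ge_1[OF \<open>r \<le> 0\<close>] khat_scaleR ang_diff_def)
  then show ?B
    unfolding eq by (simp add: norm_mult)
qed

section \<open>Positivity of the shell constant and divergence of the norm\<close>

text \<open>The profile vanishes only where \<open>k\<close> is orthogonal to \<open>v - w\<close>.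
  The rest of the shell is open and nonempty, so it is not a null set.\<close>

lemma nn_integral_ang_diff_pos:
  assumes v: "norm v < 1" and w: "norm w < 1" and "v \<noteq> w"
  shows "(\<integral>\<^sup>+k. ennreal ((cmod (ang_diff v w k))\<^sup>2 / norm k ^ 3) *
    indicator {k. 1/2 < norm k \<and> norm k < 2/3} k \<partial>lborel) > 0"
proof (rule ccontr)
  define d where "d = v - w"
  define W where "W = {k. 1/2 < norm k \<and> norm k < 2/3 \<and> k \<bullet> d \<noteq> 0}"
  assume "\<not> ?thesis"
  then have "AE k in lborel. ennreal ((cmod (ang_diff v w k))\<^sup>2 / norm k ^ 3) *
      indicator {k. 1/2 < norm k \<and> norm k < 2/3} k = 0"
    by (subst (asm) zero_less_iff_neq_zero) (simp add: nn_integral_0_iff_AE)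
  moreover have "ennreal ((cmod (ang_diff v w k))\<^sup>2 / norm k ^ 3) *
      indicator {k. 1/2 < norm k \<and> norm k < 2/3} k \<noteq> 0" if "k \<in> W" for k
  proof -
    have "norm k > 0" and kd: "k \<bullet> d \<noteq> 0" and k: "1/2 < norm k" "norm k < 2/3"
      using that by (auto simp: W_def)
    have "khat k \<bullet> v \<noteq> khat k \<bullet> w"
    proof
      assume "khat k \<bullet> v = khat k \<bullet> w"
      then have "khat k \<bullet> d = 0" by (simp add: d_def inner_diff_right)
      then show False using kd \<open>norm k > 0\<close> by (auto simp: khat_def)
    qed
    then have "1 / (1 - khat k \<bullet> v) \<noteq> 1 / (1 - khat k \<bullet> w)"
      using inner_khat_less_1[OF v, of k] inner_khat_less_1[OF w, of k] by (simp add: frac_eq_eq)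
    then have "ang_diff v w k \<noteq> 0"
      by (simp only: ang_diff_def of_real_eq_0_iff right_minus_eq not_False_eq_True)
    then have "(cmod (ang_diff v w k))\<^sup>2 / norm k ^ 3 > 0"
      using \<open>norm k > 0\<close> by simp
    then show ?thesis
      using k by (simp add: ennreal_eq_0_iff not_le)
  qed
  ultimately have "AE k in lborel. k \<notin> W"
    by (auto elim!: eventually_mono)
  moreover have "open W"
    unfolding W_def by (intro open_Collect_conj open_Collect_less open_Collect_neq continuous_intros)
  ultimately have "W = {}"
    by (intro AE_lborel_open_imp_empty)
  \<comment> \<open>7/12 is the midpoint of 1/2 and 2/3.\<close>
  moreover have "(7 / 12 / norm d) *\<^sub>R d \<in> W"
    using \<open>v \<noteq> w\<close> by (auto simp: W_def d_def)
  ultimately show False by simp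
qed

lemma l2norm_greater:
  assumes "ennreal x \<le> (\<integral>\<^sup>+k. ennreal ((cmod (f k))\<^sup>2) \<partial>lborel)" "B\<^sup>2 < x"
  shows "ereal B < l2norm f"
proof (cases "(\<integral>\<^sup>+k. ennreal ((cmod (f k))\<^sup>2) \<partial>lborel) = top")
  case True
  then show ?thesis by (simp add: l2norm_def)
next
  case False
  then have "ennreal x \<le> ennreal (enn2real (\<integral>\<^sup>+k. ennreal ((cmod (f k))\<^sup>2) \<partial>lborel))"
    using assms(1) by (simp add: ennreal_enn2real_if)
  then have "x \<le> enn2real (\<integral>\<^sup>+k. ennreal ((cmod (f k))\<^sup>2) \<partial>lborel)"
    by (simp only: ennreal_le_iff[OF enn2real_nonneg])
  then have "B < sqrt (enn2real (\<integral>\<^sup>+k. ennreal ((cmod (f k))\<^sup>2) \<partial>lborel))"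
    using assms(2) by (intro real_less_rsqrt) linarith
  then show ?thesis
    using False by (simp add: l2norm_def)
qed

theorem theorem4p1:
  fixes r :: real and j0 :: "R3 \<Rightarrow> real" and vin vout :: R3
  assumes "r \<le> 0"
    and "test_function j0"
    and "spherically_symmetric j0"
    and "(LINT x|lborel. j0 x) \<noteq> 0"
    and "norm vin < 1" and "norm vout < 1" and "vin \<noteq> vout"
  shows "((\<lambda>\<sigma>. l2norm (T_op r (\<lambda>k. gcut j0 vout \<sigma> k - gcut j0 vin \<sigma> k))) \<longlongrightarrow> PInfty)
           (at_right 0)"
proof -
  have j: "integrable lborel j0"
    using assms(2) by (rule integrable_test_function)
  define a0 where "a0 = fourier3 j0 0"
  have "a0 \<noteq> 0"
    using assms(4) unfolding a0_def fourier3_0 by simp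
  have sin_pos: "sin (1/4 :: real) > 0"
    using pi_gt3 by (intro sin_gt_zero) auto
  \<comment> \<open>The deviation from the value at 0 that \<open>T_op_shell_lower_bound\<close>
    tolerates; all shells from \<open>i0\<close> on meet it.\<close>
  define \<eta> where "\<eta> = cmod a0 * sin (1/4) / 4"
  have "\<eta> > 0"
    using \<open>a0 \<noteq> 0\<close> sin_pos by (simp add: \<eta>_def)
  have "isCont (fourier3 j0) 0"
    using continuous_fourier3[OF j] by (simp add: continuous_on_eq_continuous_at)
  then obtain \<delta> where "\<delta> > 0" and \<delta>: "\<And>k. norm k < \<delta> \<Longrightarrow> cmod (fourier3 j0 k - a0) < \<eta>"
    using \<open>\<eta> > 0\<close> unfolding continuous_at_eps_delta a0_def dist_norm by (metis diff_zero)
  obtain i0 where i0: "i0 \<ge> 1" "eps i0 < \<delta>"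
  proof -
    have "eventually (\<lambda>i. eps i < \<delta>) sequentially"
      using eps_tendsto_0 \<open>\<delta> > 0\<close> by (rule order_tendstoD)
    then have "eventually (\<lambda>i. i \<ge> 1 \<and> eps i < \<delta>) sequentially"
      using eventually_ge_at_top[of 1] by eventually_elim simp
    then show thesis
      using that by (auto simp: eventually_sequentially)
  qed
  define C where "C = ennreal ((cmod a0 * sin (1/4) / 2)\<^sup>2 / 2) *
    (\<integral>\<^sup>+k. ennreal ((cmod (ang_diff vout vin k))\<^sup>2 / norm k ^ 3) *
      indicator {k. 1/2 < norm k \<and> norm k < 2/3} k \<partial>lborel)"
  have "C > 0"
    unfolding C_def using nn_integral_ang_diff_pos[of vout vin] assms(5,6,7) \<open>a0 \<noteq> 0\<close> sin_pos
    by (auto simp: ennreal_zero_less_mult_iff)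
  \<comment> \<open>\<open>C\<close> has not been shown finite, so a positive real below it is
    taken.\<close>
  then obtain c where "c > 0" "ennreal c \<le> C"
  proof (cases C)
    case (real x)
    then show thesis using that[of x] \<open>C > 0\<close> by (auto simp: ennreal_less_zero_iff)
  next
    case top
    then show thesis using that[of 1] by simp
  qed
  \<comment> \<open>The \<open>n\<close> shells with indices from \<open>i0\<close> to
    \<open>i0 + n - 1\<close> lie above the cutoff, the innermost having inner radius
    \<open>eps (i0 + n)\<close>. They are disjoint and each contributes at least
    \<open>C / 2\<close>.\<close>
  have bound: "ennreal (real n * c / 2) \<le>
      (\<integral>\<^sup>+k. ennreal ((cmod (T_op r (\<lambda>k. gcut j0 vout \<sigma> k - gcut j0 vin \<sigma> k) k))\<^sup>2) \<partial>lborel)"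
    if \<sigma>: "\<sigma> \<le> eps (i0 + n)" for n \<sigma>
  proof -
    define X where "X = (\<lambda>k. ennreal ((cmod (T_op r (\<lambda>k. gcut j0 vout \<sigma> k - gcut j0 vin \<sigma> k) k))\<^sup>2))"
    define I where "I = {i0..<i0 + n}"
    have shell: "(\<lambda>k. X k * indicator (shell i) k) \<in> borel_measurable borel"
        "C \<le> 2 * (\<integral>\<^sup>+k. X k * indicator (shell i) k \<partial>lborel)" if "i \<in> I" for i
    proof -
      have i: "i \<ge> 1" "\<sigma> \<le> eps (Suc i)" "eps i < \<delta>"
        using that i0 \<sigma> eps_antimono[of "Suc i" "i0 + n"] eps_antimono[of i0 i] by (auto simp: I_def)
      have near: "cmod (fourier3 j0 k - fourier3 j0 0) \<le> cmod (fourier3 j0 0) * sin (1/4) / 4"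
        if "norm k < eps i" for k
        using \<delta>[of k] that i by (simp add: \<eta>_def a0_def)
      show "(\<lambda>k. X k * indicator (shell i) k) \<in> borel_measurable borel"
        "C \<le> 2 * (\<integral>\<^sup>+k. X k * indicator (shell i) k \<partial>lborel)"
        using T_op_shell_lower_bound[OF \<open>r \<le> 0\<close> j assms(6,5) i(1,2) near]
        by (simp_all only: X_def C_def a0_def)
    qed
    have "of_nat n * C = (\<Sum>i\<in>I. C)"
      by (simp add: I_def)
    also have "\<dots> \<le> (\<Sum>i\<in>I. 2 * (\<integral>\<^sup>+k. X k * indicator (shell i) k \<partial>lborel))"
      using shell(2) by (rule sum_mono)
    also have "\<dots> = 2 * (\<integral>\<^sup>+k. (\<Sum>i\<in>I. X k * indicator (shell i) k) \<partial>lborel)"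
      using shell(1) by (subst nn_integral_sum) (auto simp: sum_distrib_left)
    also have "\<dots> \<le> 2 * (\<integral>\<^sup>+k. X k \<partial>lborel)"
    proof (intro mult_left_mono nn_integral_mono)
      fix k
      have "(\<Sum>i\<in>I. X k * indicator (shell i) k) = X k * indicator (\<Union>(shell ` I)) k"
        by (simp add: I_def indicator_UN_disjoint disjoint_family_shell sum_distrib_left)
      also have "\<dots> \<le> X k"
        by (simp add: indicator_def)
      finally show "(\<Sum>i\<in>I. X k * indicator (shell i) k) \<le> X k" .
    qed simp
    finally have "of_nat n * C \<le> 2 * (\<integral>\<^sup>+k. X k \<partial>lborel)" .
    moreover have "of_nat n * ennreal c \<le> of_nat n * C"
      using \<open>ennreal c \<le> C\<close> by (intro mult_left_mono) auto
    moreover have "of_nat n * ennreal c = 2 * ennreal (real n * c / 2)"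
      using \<open>c > 0\<close> by (simp add: ennreal_of_nat_eq_real_of_nat flip: ennreal_mult ennreal_numeral)
    ultimately have "2 * ennreal (real n * c / 2) \<le> 2 * (\<integral>\<^sup>+k. X k \<partial>lborel)"
      by simp
    then show ?thesis
      by (simp add: ennreal_mult_le_mult_iff X_def)
  qed
  have "eventually (\<lambda>\<sigma>. ereal B < l2norm (T_op r (\<lambda>k. gcut j0 vout \<sigma> k - gcut j0 vin \<sigma> k))) (at_right 0)" for B
  proof -
    \<comment> \<open>Enough shells to exceed \<open>B\<^sup>2\<close>; the bound then holds for all
      positive \<open>\<sigma>\<close> below \<open>eps (i0 + n)\<close>.\<close>
    obtain n where "2 * B\<^sup>2 / c < real n"
      using reals_Archimedean2 by blast
    then have "B\<^sup>2 < real n * c / 2"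
      using \<open>c > 0\<close> by (simp add: field_simps)
    then show ?thesis
      using bound[of _ n, THEN l2norm_greater] eps_pos[of "i0 + n"]
      unfolding eventually_at_right_field by (meson less_imp_le)
  qed
  then show ?thesis
    unfolding infinity_ereal_def[symmetric] tendsto_PInfty by blast
qed

end
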